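(* Let $a,b\in\mathbb{C}$ with $a+b=1$. Then for all complex $y,z$ with $|y|<1$ and $|z|<1$, $$\prod_{\substack{j,k\ge 1,\ j\le k\\ \gcd(j,k)=1}}\left(\frac{1}{1-y^jz^k}\right)^{\frac{1}{j^a k^b}}=\exp\left\{\sum_{n=1}^{\infty}\left(\sum_{m=1}^{n}\frac{y^m}{m^a}\right)\frac{z^n}{n^b}\right\},$$ where the product runs over all pairs $(j,k)$ of positive integers with $j\le k$ and $\gcd(j,k)=1$.
   Context: For a positive integer $j$ and complex $s$, $j^s=e^{s\ln j}$. For $|w|<1$ and complex $c$, $\left(\frac{1}{1-w}\right)^{c}$ means $\exp\left(-c\log(1-w)\right)$ with the principal branch of the logarithm. *)

theory Defs
  imports "HOL-Analysis.Analysis"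
begin

text \<open>
  Unordered infinite product over an index set: the multiplicative analogue of \<open>has_sum\<close>,
  which the library provides only for sequences (\<open>has_prod\<close>).  A limit \<open>p = 0\<close>
  is not excluded here; for \<open>p \<noteq> 0\<close> the relation is convergence of the infinite product in the
  usual sense, independently of the order of the factors.
\<close>
definition has_prod_on ::
    "('i \<Rightarrow> 'a::{comm_monoid_mult, topological_space}) \<Rightarrow> 'i set \<Rightarrow> 'a \<Rightarrow> bool" where
  "has_prod_on f A p \<longleftrightarrow> (prod f \<longlongrightarrow> p) (finite_subsets_at_top A)"

text \<open>
  The power \<open>(1 / (1 - w))\<^sup>c\<close> for \<open>\<bar>w\<bar> < 1\<close>; \<open>Ln\<close> is the principal branch.
\<close>
definition recip_one_minus_pow :: "complex \<Rightarrow> complex \<Rightarrow> complex" where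
  "recip_one_minus_pow w c = exp (- c * Ln (1 - w))"

definition visible_pairs :: "(nat \<times> nat) set" where
  "visible_pairs = {(j, k). 1 \<le> j \<and> 1 \<le> k \<and> j \<le> k \<and> coprime j k}"

end

theory Submission
  imports Defs "HOL-Real_Asymp.Real_Asymp"
begin

text \<open>
  Every pair \<open>1 \<le> m \<le> n\<close> is uniquely \<open>(h j, h k)\<close> with \<open>(j, k)\<close> visible and \<open>h \<ge> 1\<close>. Since
  \<open>a + b = 1\<close>, the term \<open>y\<^sup>m z\<^sup>n / (m\<^sup>a n\<^sup>b)\<close> becomes \<open>(y\<^sup>j z\<^sup>k)\<^sup>h / h\<close> divided by \<open>j\<^sup>a k\<^sup>b\<close>, so
  summing over \<open>h\<close> gives the logarithm of the factor at \<open>(j, k)\<close>, while summing over \<open>m\<close> first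
  gives the series on the right-hand side. The double series converges absolutely.
\<close>

text \<open>On finite sets \<open>exp\<close> turns sums into products, and its continuity passes
  this to the limit along the same filter. So it suffices to sum logarithms of the factors.\<close>

lemma has_prod_on_exp:
  fixes f :: "'i \<Rightarrow> 'a::{real_normed_field, banach}"
  assumes "(f has_sum s) A"
  shows "has_prod_on (\<lambda>x. exp (f x)) A (exp s)"
proof -
  have "((\<lambda>F. exp (sum f F)) \<longlongrightarrow> exp s) (finite_subsets_at_top A)"
    using assms unfolding has_sum_def by (rule tendsto_exp)
  moreover have "\<forall>\<^sub>F F in finite_subsets_at_top A. exp (sum f F) = prod (\<lambda>x. exp (f x)) F"
    using eventually_finite_subsets_at_top_weakI[of A "finite"]
    by (rule eventually_mono) (simp_all add: exp_sum)
  ultimately show ?thesis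
    unfolding has_prod_on_def by (rule Lim_transform_eventually)
qed

text \<open>Comparison with the geometric series gives absolute convergence, which upgrades the
  ordered power series of the logarithm to an unordered sum.\<close>

lemma Ln_series_has_sum:
  assumes "norm w < 1"
  shows "((\<lambda>n. w ^ n / of_nat n) has_sum - Ln (1 - w)) {1..}"
proof -
  have "(\<lambda>n. - (- (w ^ n / of_nat n))) sums - Ln (1 - w)"
    using Ln_series'[of "- w"] assms by (intro sums_minus) simp_all
  moreover have "summable (\<lambda>n. norm (w ^ n / of_nat n))"
  proof (rule summable_comparison_test')
    show "summable (\<lambda>n. norm w ^ n)"
      using assms by (intro summable_geometric) simp
    show "norm (norm (w ^ n / of_nat n)) \<le> norm w ^ n" if "n \<ge> 1" for n
      using that by (simp add: norm_divide norm_power divide_le_eq mult_right_le_one_le mult_le_cancel_left1)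
  qed
  ultimately have "((\<lambda>n. w ^ n / of_nat n) has_sum - Ln (1 - w)) UNIV"
    by (intro norm_summable_imp_has_sum) simp_all
  \<comment> \<open>Index 0 may be dropped: its term is \<open>1 / 0 = 0\<close>.\<close>
  also have "?this \<longleftrightarrow> ?thesis"
    by (rule has_sum_cong_neutral) (auto simp: not_le)
  finally show ?thesis .
qed

lemma summable_power_times_powr:
  fixes r c :: real
  assumes "0 \<le> r" "r < 1"
  shows "summable (\<lambda>n. r ^ n * real n powr c)"
proof (cases "r = 0")
  case True
  then show ?thesis
    by (intro summable_finite[of "{0}"]) auto
next
  case False
  \<comment> \<open>Any ratio strictly between \<open>r\<close> and 1 works: the gap absorbs the
    factor \<open>real n powr c\<close>, whatever \<open>c\<close> is.\<close>
  define s where "s = (r + 1) / 2"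
  have s: "r < s" "0 < s" "s < 1" and r: "0 < r"
    using assms False by (auto simp: s_def)
  have "(\<lambda>n. r ^ n * real n powr c) \<in> O(\<lambda>n. s ^ n)"
    using s r by real_asymp
  moreover have "summable (\<lambda>n. norm (s ^ n))"
    using s by (simp add: summable_geometric norm_power)
  ultimately show ?thesis
    by (rule summable_comparison_test_bigo[rotated])
qed

lemma abs_summable_on_power_over_powr:
  fixes y c :: complex
  assumes "norm y < 1"
  shows "(\<lambda>n. norm (y ^ n / of_nat n powr c)) summable_on UNIV"
proof -
  \<comment> \<open>Only \<open>Re c\<close> affects the modulus, the base being a nonnegative real.
    At \<open>n = 0\<close> both sides are 0, since \<open>0 powr c = 0\<close> and division by 0
    gives 0.\<close>
  have "norm (y ^ n / of_nat n powr c) = norm y ^ n * real n powr - Re c" for n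
    by (cases "n = 0") (simp_all add: norm_divide norm_power norm_powr_real_powr powr_minus field_simps)
  then show ?thesis
    using summable_power_times_powr[of "norm y" "- Re c"] assms
    by (simp add: summable_on_UNIV_nonneg_real_iff)
qed

lemma abs_summable_on_times:
  fixes f :: "'a \<Rightarrow> 'c::{real_normed_field, banach}" and g :: "'b \<Rightarrow> 'c"
  assumes "(\<lambda>x. norm (f x)) summable_on A" "(\<lambda>y. norm (g y)) summable_on B"
  shows "(\<lambda>p. norm (case p of (x, y) \<Rightarrow> f x * g y)) summable_on A \<times> B"
proof (rule summable_on_SigmaI)
  show "((\<lambda>y. norm (case (x, y) of (x, y) \<Rightarrow> f x * g y)) has_sum
          norm (f x) * (\<Sum>\<^sub>\<infinity>y\<in>B. norm (g y))) B" for x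
    using assms(2) by (simp add: norm_mult has_sum_cmult_right)
  show "(\<lambda>x. norm (f x) * (\<Sum>\<^sub>\<infinity>y\<in>B. norm (g y))) summable_on A"
    using assms(1) by (rule summable_on_cmult_left)
qed simp

text \<open>Dividing a pair by its gcd inverts the map: coprimality of \<open>j\<close> and
  \<open>k\<close> makes \<open>h\<close> the gcd of \<open>h * j\<close> and
  \<open>h * k\<close>.\<close>

lemma bij_betw_visible_pairs_times:
  "bij_betw (\<lambda>((j, k), h). (h * j, h * k)) (visible_pairs \<times> {1..})
     {(m, n). 1 \<le> m \<and> m \<le> (n::nat)}"
proof (rule bij_betw_byWitness[where f' = "\<lambda>(m, n). ((m div gcd m n, n div gcd m n), gcd m n)"])
  show "\<forall>x\<in>visible_pairs \<times> {1..}.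
     (\<lambda>(m, n). ((m div gcd m n, n div gcd m n), gcd m n))
       ((\<lambda>((j, k), h). (h * j, h * k)) x) = x"
    by (auto simp: visible_pairs_def gcd_mult_left)
  show "(\<lambda>((j, k), h). (h * j, h * k)) ` (visible_pairs \<times> {1..})
      \<subseteq> {(m, n). 1 \<le> m \<and> m \<le> n}"
    by (auto simp: visible_pairs_def)
  show "(\<lambda>(m, n). ((m div gcd m n, n div gcd m n), gcd m n)) ` {(m, n). 1 \<le> m \<and> m \<le> (n::nat)}
      \<subseteq> visible_pairs \<times> {1..}"
    by (auto simp: visible_pairs_def div_le_mono div_gcd_coprime Suc_le_eq div_greater_zero_iff
          gcd_le1_nat gcd_le2_nat)
qed auto

text \<open>For general complex bases the principal branch can break this law; nonnegative real
  bases avoid the problem.\<close>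

lemma of_nat_mult_powr:
  "(of_nat (m * n) :: complex) powr c = of_nat m powr c * of_nat n powr c"
  by (simp add: powr_times_real)

theorem theorem3p1:
  fixes a b y z :: complex
  assumes "a + b = 1" and "norm y < 1" and "norm z < 1"
  shows "summable (\<lambda>n. (\<Sum>m=1..Suc n. y ^ m / of_nat m powr a)
                        * (z ^ Suc n / of_nat (Suc n) powr b)) \<and>
         has_prod_on
           (\<lambda>(j, k). recip_one_minus_pow (y ^ j * z ^ k)
                       (1 / (of_nat j powr a * of_nat k powr b)))
           visible_pairs
           (exp (\<Sum>n. (\<Sum>m=1..Suc n. y ^ m / of_nat m powr a)
                        * (z ^ Suc n / of_nat (Suc n) powr b)))"
proof -
  define T where "T = {(m, n). 1 \<le> m \<and> m \<le> (n::nat)}"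
  define g where "g = (\<lambda>(m, n). y ^ m / of_nat m powr a * (z ^ n / of_nat n powr b))"
  define c where "c = (\<lambda>n. (\<Sum>m=1..Suc n. y ^ m / of_nat m powr a)
                        * (z ^ Suc n / of_nat (Suc n) powr b))"
  \<comment> \<open>On the full grid the variables separate, so absolute convergence follows from
    two single series; it is then restricted to \<open>T\<close>.\<close>
  have "(\<lambda>p. norm (g p)) summable_on UNIV \<times> UNIV"
    unfolding g_def using assms(2,3)
    by (intro abs_summable_on_times[where f = "\<lambda>m. y ^ m / of_nat m powr a"
            and g = "\<lambda>n. z ^ n / of_nat n powr b"]) (rule abs_summable_on_power_over_powr, assumption)+
  then have "g summable_on UNIV \<times> UNIV"
    by (rule abs_summable_summable)
  then have "g summable_on T"
    by (rule summable_on_subset_banach) simp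
  then obtain S where S: "(g has_sum S) T"
    by (auto simp: summable_on_def)

  \<comment> \<open>First grouping of \<open>S\<close>: by \<open>n\<close>, with a finite inner sum
    over \<open>m\<close>. The shift to \<open>Suc n\<close> matches a series indexed from
    0.\<close>
  have "bij_betw (\<lambda>(n, m). (m, Suc n)) (SIGMA n:UNIV. {1..Suc n}) T"
    by (rule bij_betw_byWitness[where f' = "\<lambda>(m, n). (n - 1, m)"]) (auto simp: T_def)
  from has_sum_reindex_bij_betw[OF this, of g S] S
  have "((\<lambda>(n, m). g (m, Suc n)) has_sum S) (SIGMA n:UNIV. {1..Suc n})"
    by (simp add: case_prod_unfold)
  then have "(c has_sum S) UNIV"
  proof (rule has_sum_SigmaD)
    show "((\<lambda>m. case (n, m) of (n, m) \<Rightarrow> g (m, Suc n)) has_sum c n) {1..Suc n}" for n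
      unfolding c_def g_def prod.case sum_distrib_right by (rule has_sum_finite) simp
  qed
  then have sums: "c sums S"
    by (rule has_sum_imp_sums)

  \<comment> \<open>\<open>exp\<close> of \<open>L\<close> is the factor by definition, so no branch
    question arises when the factors are multiplied.\<close>
  define L where "L = (\<lambda>(j, k). - (1 / (of_nat j powr a * of_nat k powr b)) * Ln (1 - y ^ j * z ^ k))"
  \<comment> \<open>Second grouping of the same \<open>S\<close>: by visible pair, with inner sum
    over the multiplier \<open>h\<close>.\<close>
  from has_sum_reindex_bij_betw[OF bij_betw_visible_pairs_times, of g S] S
  have "((\<lambda>(p, h). g (h * fst p, h * snd p)) has_sum S) (visible_pairs \<times> {1..})"
    by (simp add: T_def case_prod_unfold)
  then have "(L has_sum S) visible_pairs"
  proof (rule has_sum_SigmaD)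
    fix p assume "p \<in> visible_pairs"
    then obtain j k where p: "p = (j, k)" "j \<ge> 1" "k \<ge> 1"
      by (auto simp: visible_pairs_def)
    define w where "w = y ^ j * z ^ k"
    define d where "d = 1 / (of_nat j powr a * of_nat k powr b :: complex)"
    have "norm y ^ j < 1" "norm z ^ k < 1"
      using p assms by (simp_all add: power_less_one_iff)
    then have "norm w < 1"
      unfolding w_def norm_mult norm_power
      using mult_strict_mono[of "norm y ^ j" 1 "norm z ^ k" 1] by simp
    from has_sum_cmult_right[OF Ln_series_has_sum[OF this], of d]
    have "((\<lambda>h. d * (w ^ h / of_nat h)) has_sum L p) {1..}"
      by (simp add: L_def p d_def w_def)
    also have "?this \<longleftrightarrow> ((\<lambda>h. case (p, h) of (p, h) \<Rightarrow> g (h * fst p, h * snd p)) has_sum L p) {1..}"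
    proof (rule has_sum_cong)
      fix h :: nat assume "h \<in> {1..}"
      \<comment> \<open>Here \<open>a + b = 1\<close> enters: the powers of \<open>h\<close> from
        both denominators merge into the single \<open>h\<close> of the logarithm series.\<close>
      then have "(of_nat h :: complex) powr a * of_nat h powr b = of_nat h"
        using assms(1) by (simp flip: powr_add)
      then show "d * (w ^ h / of_nat h) = (case (p, h) of (p, h) \<Rightarrow> g (h * fst p, h * snd p))"
        unfolding g_def p d_def w_def prod.case fst_conv snd_conv of_nat_mult_powr
        by (simp add: power_mult_distrib power_mult mult_ac flip: power_mult)
    qed
    finally show "((\<lambda>h. case (p, h) of (p, h) \<Rightarrow> g (h * fst p, h * snd p)) has_sum L p) {1..}" .
  qed
  then have "has_prod_on (\<lambda>x. exp (L x)) visible_pairs (exp S)"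
    by (rule has_prod_on_exp)
  also have "(\<lambda>x. exp (L x)) = (\<lambda>(j, k). recip_one_minus_pow (y ^ j * z ^ k)
                       (1 / (of_nat j powr a * of_nat k powr b)))"
    by (auto simp: L_def recip_one_minus_pow_def)
  finally show ?thesis
    using sums unfolding c_def by (auto simp: sums_iff)
qed

end
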